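(* Let $m\ge1$ be an integer, and let $x,y,z,q$ be complex numbers with $|q|<1$ such that all denominators occurring below are nonzero. (i) Let $$\phi(x,y,z,q):=\sum_{n=0}^{\infty}\frac{x^{n}q^{n(n+1)/2}(-z;q)_{n}}{(y;q)_{n+1}(q;q)_{n}},\qquad e_k(x,y,z,q):=\sum_{n\ge 0}x^{n}q^{n(n+1)/2}\sum_{j\ge 0}\begin{bmatrix} n+j\\ j\end{bmatrix}y^{j}\sum_{l\ge 0}\begin{bmatrix} k-1-j-l\\ n\end{bmatrix}q^{l(l-1)/2}z^{l}\begin{bmatrix} n\\ l\end{bmatrix}$$ for positive integers $k$. Then $$\phi(xq^{-m},y,z,q)=e_{m+1}(xq^{-m},y,z,q)\,\phi(x,y,z,q)+(zx-y)\,e_{m}(xq^{-m},y,z,q)\,\phi(xq,y,z,q).$$ (ii) Let $$\Phi(x,y,z,q):=\sum_{n=0}^{\infty}\frac{x^{n}q^{n(n+1)/2}(-z;q)_{n}}{(-xyq;q)_{n}(q;q)_{n}},$$ $$g_k(x,y,z,q):=\sum_{n,j,l\ge0}x^{n}y^{j}z^{l}q^{n(n+1)/2+l(l-1)/2}\begin{bmatrix} k-1-n+j\\ j\end{bmatrix}\begin{bmatrix} k-1-j-l\\ n-j-l\end{bmatrix}\begin{bmatrix} k-1-n\\ l\end{bmatrix}$$ for positive integers $k$. Then $$\Phi(xq^{-m},y,z,q)=\frac{q^{m(m-1)/2}}{x^my^m(-1/(xy);q)_m}\Big[g_{m+1}(xq^{-m},y,z,q)\,\Phi(x,y,z,q)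+\frac{zx-x^2yq}{1+xyq}\,g_{m}(xq^{-m},y,z,q)\,\Phi(xq,y,z,q)\Big].$$
   Context: $(a;q)_n=\prod_{k=0}^{n-1}(1-aq^k)$ for $n\ge 0$. The Gaussian polynomial $\begin{bmatrix} N\\ M\end{bmatrix}$ equals $\frac{(q;q)_N}{(q;q)_M(q;q)_{N-M}}$ if $0\le M\le N$ and $0$ otherwise. All summation indices range over nonnegative integers. *)

theory Defs
  imports "HOL-Analysis.Analysis"
begin

definition qpoch :: "complex \<Rightarrow> complex \<Rightarrow> nat \<Rightarrow> complex" where
  "qpoch a q n = (\<Prod>k<n. 1 - a * q ^ k)"

text \<open>The arguments are integers, since the upper and lower entries may become negative in the
  sums below. The quotient is the Gaussian polynomial as long as \<open>q\<close> is not a root of unity.\<close>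

definition gauss_binom :: "complex \<Rightarrow> int \<Rightarrow> int \<Rightarrow> complex" where
  "gauss_binom q N M =
     (if 0 \<le> M \<and> M \<le> N
      then qpoch q q (nat N) / (qpoch q q (nat M) * qpoch q q (nat (N - M)))
      else 0)"

definition phi :: "complex \<Rightarrow> complex \<Rightarrow> complex \<Rightarrow> complex \<Rightarrow> complex" where
  "phi x y z q =
     (\<Sum>n. x ^ n * q ^ (n * (n + 1) div 2) * qpoch (- z) q n / (qpoch y q (n + 1) * qpoch q q n))"

text \<open>The sums in \<open>e_poly\<close> and \<open>g_poly\<close> have finite support: terms vanish unless
  \<open>n + j + l < k\<close> and \<open>j + l \<le> n < k\<close>, respectively.\<close>

definition e_poly :: "nat \<Rightarrow> complex \<Rightarrow> complex \<Rightarrow> complex \<Rightarrow> complex \<Rightarrow> complex" where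
  "e_poly k x y z q =
     (\<Sum>n. x ^ n * q ^ (n * (n + 1) div 2) *
       (\<Sum>j. gauss_binom q (int n + int j) (int j) * y ^ j *
         (\<Sum>l. gauss_binom q (int k - 1 - int j - int l) (int n) *
               q ^ (l * (l - 1) div 2) * z ^ l * gauss_binom q (int n) (int l))))"

definition Phi :: "complex \<Rightarrow> complex \<Rightarrow> complex \<Rightarrow> complex \<Rightarrow> complex" where
  "Phi x y z q =
     (\<Sum>n. x ^ n * q ^ (n * (n + 1) div 2) * qpoch (- z) q n /
          (qpoch (- (x * y * q)) q n * qpoch q q n))"

definition g_poly :: "nat \<Rightarrow> complex \<Rightarrow> complex \<Rightarrow> complex \<Rightarrow> complex \<Rightarrow> complex" where
  "g_poly k x y z q =
     (\<Sum>\<^sub>\<infinity>(n, j, l)\<in>UNIV.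
        x ^ n * y ^ j * z ^ l * q ^ (n * (n + 1) div 2 + l * (l - 1) div 2) *
        gauss_binom q (int k - 1 - int n + int j) (int j) *
        gauss_binom q (int k - 1 - int j - int l) (int n - int j - int l) *
        gauss_binom q (int k - 1 - int n) (int l))"

end

theory Submission
  imports Defs
begin

text \<open>
  Both families of polynomials come from the power series
  \<open>c\<^sub>N(t) = (-zt;q)\<^sub>N / ((yt;q)\<^bsub>N+1\<^esub> (t;q)\<^bsub>N+1\<^esub>)\<close>: by the \<open>q\<close>-binomial theorem,
  \<open>e\<^sub>k = \<Sum>\<^sub>n x\<^sup>n q\<^bsup>n(n+1)/2\<^esup> [t\<^bsup>k-1-n\<^esup>] c\<^sub>n(t)\<close> and
  \<open>g\<^sub>k = \<Sum>\<^sub>n x\<^sup>n q\<^bsup>n(n+1)/2\<^esup> [t\<^sup>n] c\<^bsub>k-1-n\<^esub>(t)\<close>.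
  Splitting off the first factors of \<open>c\<^sub>N(t)\<close> relates it to \<open>c\<^bsub>N-1\<^esub>(qt)\<close> and gives a three-term
  recurrence in \<open>k\<close> for \<open>e\<^sub>k\<close>; splitting off the last factors relates it to \<open>c\<^bsub>N-1\<^esub>(t)\<close> and gives
  one for \<open>g\<^sub>k\<close>. They match the \<open>q\<close>-difference equations
  \<open>\<phi>(x) = (1 + y + xq) \<phi>(xq) + (zxq - y) \<phi>(xq\<^sup>2)\<close> and
  \<open>(1 + xyq) \<Phi>(x) = (1 + xq + xyq) \<Phi>(xq) + (zxq - x\<^sup>2yq\<^sup>3) / (1 + xyq\<^sup>2) \<Phi>(xq\<^sup>2)\<close>,
  so both identities follow by induction on \<open>m\<close>.
\<close>

section \<open>Triangular exponents and \<open>q\<close>-Pochhammer symbols\<close>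

lemma triangular_Suc: "Suc n * (Suc n + 1) div 2 = n * (n + 1) div 2 + Suc n"
proof -
  have eq: "Suc n * (Suc n + 1) = n * (n + 1) + Suc n * 2" by simp
  show ?thesis unfolding eq by (subst div_mult_self1) simp_all
qed

lemma qpoch_0 [simp]: "qpoch a q 0 = 1"
  by (simp add: qpoch_def)

lemma qpoch_Suc: "qpoch a q (Suc n) = qpoch a q n * (1 - a * q ^ n)"
  by (simp add: qpoch_def)

lemma qpoch_Suc_left: "qpoch a q (Suc n) = (1 - a) * qpoch (a * q) q n"
  unfolding qpoch_def by (subst prod.lessThan_Suc_shift) (simp add: algebra_simps)

lemma qpoch_factor_nonzero:
  assumes "\<forall>n. qpoch a q n \<noteq> 0"
  shows "1 - a * q ^ n \<noteq> 0"
  using assms[rule_format, of "Suc n"] by (auto simp: qpoch_Suc)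

lemma qpoch_shift_nonzero:
  assumes "\<forall>n. qpoch a q n \<noteq> 0"
  shows "\<forall>n. qpoch (a * q) q n \<noteq> 0"
proof
  fix n
  show "qpoch (a * q) q n \<noteq> 0"
    using assms[rule_format, of "Suc n"] by (simp add: qpoch_Suc_left)
qed

lemma q_power_neq_1:
  fixes q :: complex
  assumes "norm q < 1"
  shows "q * q ^ n \<noteq> 1"
proof
  assume "q * q ^ n = 1"
  then have "norm q * norm q ^ n = 1"
    by (metis norm_mult norm_one norm_power)
  moreover have "norm q * norm q ^ n \<le> norm q * 1"
    using assms by (intro mult_left_mono power_le_one) auto
  ultimately show False using assms by simp
qed

lemma qpoch_q_nonzero:
  assumes "norm q < 1"
  shows "qpoch q q n \<noteq> 0"
  using q_power_neq_1[OF assms] by (simp add: qpoch_def)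

section \<open>Gaussian polynomials with natural entries and their Pascal rules\<close>

definition qb :: "complex \<Rightarrow> nat \<Rightarrow> nat \<Rightarrow> complex" where
  "qb q n k = gauss_binom q (int n) (int k)"

lemma qb_add: "qb q (n + k) k = qpoch q q (n + k) / (qpoch q q k * qpoch q q n)"
  by (simp add: qb_def gauss_binom_def nat_int_add)

lemma qb_add_sym: "qb q (n + k) k = qb q (n + k) n"
  using qb_add[of q n k] qb_add[of q k n] by (simp add: add.commute mult.commute)

lemma qb_eq_0: "n < k \<Longrightarrow> qb q n k = 0"
  by (simp add: qb_def gauss_binom_def)

lemma qb_0_right:
  assumes "norm q < 1"
  shows "qb q n 0 = 1"
  using qb_add[of q n 0] qpoch_q_nonzero[OF assms, of n] by simp

lemma qb_self:
  assumes "norm q < 1"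
  shows "qb q n n = 1"
  using qb_add[of q 0 n] qpoch_q_nonzero[OF assms, of n] by simp

text \<open>After clearing denominators this is
  \<open>1 - q^(n+k+2) = (1 - q^(k+1)) + q^(k+1) (1 - q^(n+1))\<close>. Writing the upper entry as a
  sum avoids truncated subtraction and is the form that the coefficients of
  \<open>inv_qpoch_fps\<close> need.\<close>

lemma qb_Pascal_add:
  assumes "norm q < 1"
  shows "qb q (Suc n + Suc k) (Suc k) = qb q (Suc n + k) k + q ^ Suc k * qb q (n + Suc k) (Suc k)"
proof -
  have nz: "qpoch q q j \<noteq> 0" "1 - q * q ^ j \<noteq> 0" for j
    using qpoch_q_nonzero[OF assms] q_power_neq_1[OF assms] by auto
  have "(1 - q * q ^ (Suc n + k)) = (1 - q * q ^ k) + q ^ Suc k * (1 - q * q ^ n)"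
    by (simp add: power_add algebra_simps)
  then have "qb q (Suc n + Suc k) (Suc k) = qpoch q q (Suc (n + k)) *
      ((1 - q * q ^ k) + q ^ Suc k * (1 - q * q ^ n)) / (qpoch q q (Suc k) * qpoch q q (Suc n))"
    unfolding qb_add by (simp add: qpoch_Suc)
  also have "\<dots> = qb q (Suc n + k) k + q ^ Suc k * qb q (n + Suc k) (Suc k)"
    unfolding qb_add using nz[of k] nz[of n] nz(1)[of "n + k"]
    by (simp add: qpoch_Suc divide_simps) (simp add: algebra_simps)
  finally show ?thesis .
qed

text \<open>The other Pascal rule is the first one with \<open>n\<close> and \<open>k\<close>
  exchanged, read through the symmetry \<open>qb_add_sym\<close>.\<close>

lemma qb_Pascal_add':
  assumes "norm q < 1"
  shows "qb q (Suc n + Suc k) (Suc k) = q ^ Suc n * qb q (Suc n + k) k + qb q (n + Suc k) (Suc k)"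
  using qb_Pascal_add[OF assms, of k n] qb_add_sym[of q "Suc n" "Suc k"]
    qb_add_sym[of q "Suc n" k] qb_add_sym[of q n "Suc k"]
  by (simp add: add.commute add.left_commute)

lemma qb_Pascal:
  assumes "norm q < 1"
  shows "qb q (Suc n) (Suc k) = qb q n k + q ^ Suc k * qb q n (Suc k)"
proof (cases n k rule: linorder_cases)
  case less
  then show ?thesis by (simp add: qb_eq_0)
next
  case equal
  then show ?thesis by (simp add: qb_eq_0 qb_self[OF assms])
next
  case greater
  then obtain d where "n = Suc d + k" using less_natE by (metis add.commute add_Suc)
  then show ?thesis using qb_Pascal_add[OF assms, of d k] by simp
qed

lemma qb_Pascal':
  assumes "norm q < 1"
  shows "qb q (Suc n) (Suc k) = q ^ (n - k) * qb q n k + qb q n (Suc k)"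
proof (cases n k rule: linorder_cases)
  case less
  then show ?thesis by (simp add: qb_eq_0)
next
  case equal
  then show ?thesis by (simp add: qb_eq_0 qb_self[OF assms])
next
  case greater
  then obtain d where "n = Suc d + k" using less_natE by (metis add.commute add_Suc)
  then show ?thesis using qb_Pascal_add'[OF assms, of d k] by simp
qed

section \<open>Generating series of the \<open>q\<close>-binomial theorem\<close>

text \<open>This is the substitution of \<open>qt\<close> for \<open>t\<close>, given by
  coefficients so that its compatibility with products is read off the Cauchy product.\<close>

definition fps_dilate :: "complex \<Rightarrow> complex fps \<Rightarrow> complex fps" where
  "fps_dilate q F = Abs_fps (\<lambda>n. q ^ n * fps_nth F n)"

lemma fps_nth_dilate [simp]: "fps_nth (fps_dilate q F) n = q ^ n * fps_nth F n"
  by (simp add: fps_dilate_def)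

lemma fps_dilate_mult: "fps_dilate q (F * G) = fps_dilate q F * fps_dilate q G"
proof (rule fps_ext)
  fix n
  have "q ^ n = q ^ i * q ^ (n - i)" if "i \<le> n" for i
    using that by (simp flip: power_add)
  then show "fps_nth (fps_dilate q (F * G)) n = fps_nth (fps_dilate q F * fps_dilate q G) n"
    by (auto simp: fps_mult_nth sum_distrib_left mult_ac intro!: sum.cong)
qed

text \<open>By the \<open>q\<close>-binomial theorem these are \<open>1 / (yt;q)\<^bsub>n+1\<^esub>\<close> (not \<open>1 / (yt;q)\<^sub>n\<close>) and
  \<open>(-zt;q)\<^sub>n\<close> as series in \<open>t\<close>.\<close>

definition inv_qpoch_fps :: "complex \<Rightarrow> complex \<Rightarrow> nat \<Rightarrow> complex fps" where
  "inv_qpoch_fps q y n = Abs_fps (\<lambda>j. qb q (n + j) j * y ^ j)"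

definition qpoch_fps :: "complex \<Rightarrow> complex \<Rightarrow> nat \<Rightarrow> complex fps" where
  "qpoch_fps q z n = Abs_fps (\<lambda>l. q ^ (l * (l - 1) div 2) * z ^ l * qb q n l)"

lemma inv_qpoch_fps_0:
  assumes "norm q < 1"
  shows "(1 - fps_const y * fps_X) * inv_qpoch_fps q y 0 = 1"
proof (rule fps_ext)
  fix n
  show "fps_nth ((1 - fps_const y * fps_X) * inv_qpoch_fps q y 0) n = fps_nth 1 n"
    by (cases n) (simp_all add: inv_qpoch_fps_def left_diff_distrib mult.assoc qb_self[OF assms])
qed

text \<open>Removing the first factor of \<open>(yt;q)_(n+2)\<close> leaves
  \<open>(yqt;q)_(n+1)\<close>. On coefficients this is \<open>qb_Pascal_add\<close>.\<close>

lemma inv_qpoch_fps_Suc: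
  assumes "norm q < 1"
  shows "(1 - fps_const y * fps_X) * inv_qpoch_fps q y (Suc n) = fps_dilate q (inv_qpoch_fps q y n)"
proof (rule fps_ext)
  fix k
  show "fps_nth ((1 - fps_const y * fps_X) * inv_qpoch_fps q y (Suc n)) k =
      fps_nth (fps_dilate q (inv_qpoch_fps q y n)) k"
    using qb_Pascal_add[OF assms, of n]
    by (cases k) (simp_all add: inv_qpoch_fps_def left_diff_distrib mult.assoc qb_0_right[OF assms]
        algebra_simps)
qed

text \<open>Removing the last factor of \<open>(yt;q)_(n+2)\<close> leaves
  \<open>(yt;q)_(n+1)\<close>. On coefficients this is \<open>qb_Pascal_add'\<close>.\<close>

lemma inv_qpoch_fps_Suc':
  assumes "norm q < 1"
  shows "(1 - fps_const (y * q ^ Suc n) * fps_X) * inv_qpoch_fps q y (Suc n) = inv_qpoch_fps q y n"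
proof (rule fps_ext)
  fix k
  show "fps_nth ((1 - fps_const (y * q ^ Suc n) * fps_X) * inv_qpoch_fps q y (Suc n)) k =
      fps_nth (inv_qpoch_fps q y n) k"
    using qb_Pascal_add'[OF assms, of n]
    by (cases k) (simp_all add: inv_qpoch_fps_def left_diff_distrib mult.assoc qb_0_right[OF assms]
        algebra_simps del: fps_const_mult)
qed

lemma qpoch_fps_0:
  assumes "norm q < 1"
  shows "qpoch_fps q z 0 = 1"
proof (rule fps_ext)
  fix n
  show "fps_nth (qpoch_fps q z 0) n = fps_nth 1 n"
    by (cases n) (simp_all add: qpoch_fps_def qb_eq_0 qb_self[OF assms])
qed

lemma triangular_pred_Suc: "Suc n * (Suc n - 1) div 2 = n * (n - 1) div 2 + n"
  by (cases n) (use triangular_Suc in \<open>simp_all add: mult.commute\<close>)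

text \<open>The first factor of \<open>(-zt;q)_(n+1)\<close> is split off; the coefficients agree by
  \<open>qb_Pascal\<close>.\<close>

lemma qpoch_fps_Suc:
  assumes "norm q < 1"
  shows "qpoch_fps q z (Suc n) = (1 + fps_const z * fps_X) * fps_dilate q (qpoch_fps q z n)"
proof (rule fps_ext)
  fix k
  show "fps_nth (qpoch_fps q z (Suc n)) k =
      fps_nth ((1 + fps_const z * fps_X) * fps_dilate q (qpoch_fps q z n)) k"
  proof (cases k)
    case 0
    then show ?thesis
      by (simp add: qpoch_fps_def qb_0_right[OF assms])
  next
    case (Suc l)
    show ?thesis
      unfolding Suc qpoch_fps_def
      by (simp add: distrib_right mult.assoc triangular_pred_Suc[simplified] qb_Pascal[OF assms])
        (simp add: power_add algebra_simps)
  qed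
qed

text \<open>The last factor of \<open>(-zt;q)_(n+1)\<close> is split off; the coefficients agree by
  \<open>qb_Pascal'\<close>.\<close>

lemma qpoch_fps_Suc':
  assumes "norm q < 1"
  shows "qpoch_fps q z (Suc n) = (1 + fps_const (z * q ^ n) * fps_X) * qpoch_fps q z n"
proof (rule fps_ext)
  fix k
  show "fps_nth (qpoch_fps q z (Suc n)) k =
      fps_nth ((1 + fps_const (z * q ^ n) * fps_X) * qpoch_fps q z n) k"
  proof (cases k)
    case 0
    then show ?thesis
      by (simp add: qpoch_fps_def qb_0_right[OF assms])
  next
    case (Suc l)
    show ?thesis
    \<comment> \<open>The exponent \<open>n - l\<close> in \<open>qb_Pascal'\<close> is a true
      difference only for \<open>l \<le> n\<close>; beyond that every Gaussian polynomial involved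
      is zero.\<close>
    proof (cases "l \<le> n")
      case True
      then obtain d where d: "n = l + d" using le_Suc_ex by blast
      show ?thesis
        unfolding Suc qpoch_fps_def d
        by (simp add: distrib_right mult.assoc triangular_pred_Suc[simplified] qb_Pascal'[OF assms]
            del: fps_const_mult)
          (simp add: power_add algebra_simps)
    next
      case False
      then show ?thesis
        unfolding Suc qpoch_fps_def
        by (simp add: distrib_right mult.assoc qb_eq_0 del: fps_const_mult)
    qed
  qed
qed

section \<open>The kernel series and its two functional equations\<close>

definition kernel_fps :: "complex \<Rightarrow> complex \<Rightarrow> complex \<Rightarrow> nat \<Rightarrow> complex fps" where
  "kernel_fps q y z n = inv_qpoch_fps q y n * (qpoch_fps q z n * inv_qpoch_fps q 1 n)"

lemma kernel_fps_0:
  assumes "norm q < 1"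
  shows "(1 - fps_X) * (1 - fps_const y * fps_X) * kernel_fps q y z 0 = 1"
proof -
  have "(1 - fps_X) * (1 - fps_const y * fps_X) * kernel_fps q y z 0 =
      ((1 - fps_const y * fps_X) * inv_qpoch_fps q y 0) *
      ((1 - fps_const 1 * fps_X) * inv_qpoch_fps q 1 0)"
    by (simp add: kernel_fps_def qpoch_fps_0[OF assms] mult_ac)
  then show ?thesis by (simp only: inv_qpoch_fps_0[OF assms] mult_1)
qed

text \<open>Splitting the first factor off each of the three products leaves the same products, one
  factor shorter, at \<open>qt\<close>. The factor \<open>1 - fps_X\<close> is the case
  \<open>y = 1\<close>.\<close>

lemma kernel_fps_Suc:
  assumes "norm q < 1"
  shows "(1 - fps_X) * (1 - fps_const y * fps_X) * kernel_fps q y z (Suc n) =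
    (1 + fps_const z * fps_X) * fps_dilate q (kernel_fps q y z n)"
proof -
  have "(1 - fps_X) * (1 - fps_const y * fps_X) * kernel_fps q y z (Suc n) =
      ((1 - fps_const y * fps_X) * inv_qpoch_fps q y (Suc n)) *
      (qpoch_fps q z (Suc n) * ((1 - fps_const 1 * fps_X) * inv_qpoch_fps q 1 (Suc n)))"
    by (simp add: kernel_fps_def mult_ac)
  also have "\<dots> = (1 + fps_const z * fps_X) * fps_dilate q (kernel_fps q y z n)"
    unfolding inv_qpoch_fps_Suc[OF assms] qpoch_fps_Suc[OF assms] kernel_fps_def fps_dilate_mult
    by (simp only: mult_ac)
  finally show ?thesis .
qed

text \<open>Splitting off the last factors leaves the argument \<open>t\<close> unchanged; the
  powers of \<open>q\<close> in those factors supply the weights that the dilation supplies in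
  \<open>kernel_fps_Suc\<close>.\<close>

lemma kernel_fps_Suc':
  assumes "norm q < 1"
  shows "(1 - fps_const (q ^ Suc n) * fps_X) * (1 - fps_const (y * q ^ Suc n) * fps_X) *
      kernel_fps q y z (Suc n) = (1 + fps_const (z * q ^ n) * fps_X) * kernel_fps q y z n"
proof -
  have "(1 - fps_const (q ^ Suc n) * fps_X) * (1 - fps_const (y * q ^ Suc n) * fps_X) *
      kernel_fps q y z (Suc n) =
      ((1 - fps_const (y * q ^ Suc n) * fps_X) * inv_qpoch_fps q y (Suc n)) *
      (qpoch_fps q z (Suc n) * ((1 - fps_const (1 * q ^ Suc n) * fps_X) * inv_qpoch_fps q 1 (Suc n)))"
    by (simp only: kernel_fps_def mult_ac mult_1 mult_1_right)
  also have "\<dots> = (1 + fps_const (z * q ^ n) * fps_X) * kernel_fps q y z n"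
    unfolding inv_qpoch_fps_Suc'[OF assms] qpoch_fps_Suc'[OF assms] kernel_fps_def
    by (simp only: mult_ac)
  finally show ?thesis .
qed

section \<open>The polynomials \<open>e_poly\<close> and \<open>g_poly\<close> as sums of kernel
  coefficients\<close>

text \<open>Keeping \<open>fps_X * F\<close> instead of lowering the index makes the expansion
  uniform in \<open>n\<close>, without special cases at \<open>0\<close> and
  \<open>1\<close>.\<close>

lemma fps_nth_quadratic_mult:
  fixes a b :: complex
  shows "fps_nth ((1 - fps_const a * fps_X) * (1 - fps_const b * fps_X) * F) n =
    fps_nth F n - (a + b) * fps_nth (fps_X * F) n + a * b * fps_nth (fps_X * (fps_X * F)) n"
proof -
  have "(1 - fps_const a * fps_X) * (1 - fps_const b * fps_X) * F =
    F - fps_const (a + b) * (fps_X * F) + fps_const (a * b) * (fps_X * (fps_X * F))"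
    unfolding fps_const_add[symmetric] fps_const_mult[symmetric] by (simp only: ring_distribs) algebra
  then show ?thesis by (simp only: fps_add_nth fps_sub_nth fps_mult_left_const_nth)
qed

lemma fps_nth_linear_mult:
  fixes a :: complex
  shows "fps_nth ((1 + fps_const a * fps_X) * F) n = fps_nth F n + a * fps_nth (fps_X * F) n"
  by (simp only: distrib_right mult_1 mult.assoc fps_add_nth fps_mult_left_const_nth)

text \<open>By symmetry a Gaussian polynomial with fixed lower entry \<open>n\<close> is also a
  coefficient of \<open>1 / (t;q)_(n+1)\<close>; this is the form in which the innermost sum of
  \<open>e_poly\<close> contains it.\<close>

lemma gauss_binom_eq_inv_qpoch_fps_nth:
  "gauss_binom q (int n + int i) (int n) = fps_nth (inv_qpoch_fps q 1 n) i"
  using qb_add_sym[of q n i] by (simp add: inv_qpoch_fps_def) (simp add: qb_def)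

text \<open>The sum over \<open>l\<close> is a Cauchy product. The guard excludes
  \<open>j > k - n\<close>, where all terms vanish but \<open>k - n - j\<close> would truncate to
  \<open>0\<close> and select the constant coefficient.\<close>

lemma e_poly_inner_sum:
  assumes "n \<le> k"
  shows "(\<Sum>l. gauss_binom q (int (Suc k) - 1 - int j - int l) (int n) *
      q ^ (l * (l - 1) div 2) * z ^ l * gauss_binom q (int n) (int l)) =
    (if j \<le> k - n then fps_nth (qpoch_fps q z n * inv_qpoch_fps q 1 n) (k - n - j) else 0)"
proof -
  define f where "f l = gauss_binom q (int (Suc k) - 1 - int j - int l) (int n) *
      q ^ (l * (l - 1) div 2) * z ^ l * gauss_binom q (int n) (int l)" for l
  have f0: "f l = 0" if "\<not> n + j + l \<le> k" for l
    using that by (simp add: f_def gauss_binom_def)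
  have f1: "f l = fps_nth (qpoch_fps q z n) l * fps_nth (inv_qpoch_fps q 1 n) (k - n - j - l)"
    if "n + j + l \<le> k" for l
  proof -
    have "int (Suc k) - 1 - int j - int l = int n + int (k - n - j - l)"
      using that by linarith
    then show ?thesis
      unfolding f_def by (simp only: gauss_binom_eq_inv_qpoch_fps_nth)
        (simp add: qpoch_fps_def qb_def)
  qed
  have "suminf f = sum f (if j \<le> k - n then {0..k - n - j} else {})"
    by (intro suminf_finite) (auto intro!: f0 split: if_splits)
  also have "\<dots> = (if j \<le> k - n then fps_nth (qpoch_fps q z n * inv_qpoch_fps q 1 n) (k - n - j) else 0)"
    using assms by (auto simp: fps_mult_nth simp del: diff_diff_left intro!: sum.cong f1)
  finally show ?thesis by (simp only: f_def[abs_def])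
qed

text \<open>The sum over \<open>j\<close> is a second Cauchy product, with
  \<open>1 / (yt;q)_(n+1)\<close>. Stating this at \<open>Suc k\<close> turns
  \<open>k - 1 - n\<close> into a true difference of naturals.\<close>

lemma e_poly_Suc:
  "e_poly (Suc k) x y z q =
    (\<Sum>n\<le>k. x ^ n * q ^ (n * (n + 1) div 2) * fps_nth (kernel_fps q y z n) (k - n))"
proof -
  define S where "S n = (\<Sum>j. gauss_binom q (int n + int j) (int j) * y ^ j *
         (\<Sum>l. gauss_binom q (int (Suc k) - 1 - int j - int l) (int n) *
               q ^ (l * (l - 1) div 2) * z ^ l * gauss_binom q (int n) (int l)))" for n
  have S0: "S n = 0" if "\<not> n \<le> k" for n
  proof -
    have "gauss_binom q (int (Suc k) - 1 - int j - int l) (int n) = 0" for j l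
      using that by (simp add: gauss_binom_def)
    then show ?thesis by (simp add: S_def)
  qed
  have S1: "S n = fps_nth (kernel_fps q y z n) (k - n)" if "n \<le> k" for n
  proof -
    have "S n = (\<Sum>j\<in>{0..k - n}. gauss_binom q (int n + int j) (int j) * y ^ j *
       (if j \<le> k - n then fps_nth (qpoch_fps q z n * inv_qpoch_fps q 1 n) (k - n - j) else 0))"
      unfolding S_def e_poly_inner_sum[OF that] by (intro suminf_finite) auto
    also have "\<dots> = (\<Sum>j\<in>{0..k - n}. fps_nth (inv_qpoch_fps q y n) j *
        fps_nth (qpoch_fps q z n * inv_qpoch_fps q 1 n) (k - n - j))"
      by (intro sum.cong) (auto simp: inv_qpoch_fps_def qb_def)
    finally show ?thesis by (simp add: kernel_fps_def fps_mult_nth[of "inv_qpoch_fps q y n"])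
  qed
  have "e_poly (Suc k) x y z q = (\<Sum>n. x ^ n * q ^ (n * (n + 1) div 2) * S n)"
    by (simp only: e_poly_def S_def)
  also have "\<dots> = (\<Sum>n\<le>k. x ^ n * q ^ (n * (n + 1) div 2) * S n)"
    by (intro suminf_finite) (auto simp: S0)
  finally show ?thesis by (simp add: S1)
qed

lemma e_poly_0: "e_poly 0 x y z q = 0"
proof -
  have "gauss_binom q (int 0 - 1 - int j - int l) (int n) = 0" for j l n
    by (simp add: gauss_binom_def)
  then show ?thesis by (simp add: e_poly_def)
qed

lemma g_poly_Suc:
  "g_poly (Suc k) x y z q =
    (\<Sum>n\<le>k. x ^ n * q ^ (n * (n + 1) div 2) * fps_nth (kernel_fps q y z (k - n)) n)"
proof -
  define f where "f = (\<lambda>(n, j, l). x ^ n * y ^ j * z ^ l * q ^ (n * (n + 1) div 2 + l * (l - 1) div 2) *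
        gauss_binom q (int (Suc k) - 1 - int n + int j) (int j) *
        gauss_binom q (int (Suc k) - 1 - int j - int l) (int n - int j - int l) *
        gauss_binom q (int (Suc k) - 1 - int n) (int l))"
  define S where "S = Sigma {..k} (\<lambda>n. Sigma {0..n} (\<lambda>j. {0..n - j}))"
  \<comment> \<open>Outside \<open>S\<close> either \<open>n > k\<close>, so that the upper entry of
    the last Gaussian polynomial is negative, or \<open>j + l > n\<close>, so that the lower entry
    of the middle one is.\<close>
  have f0: "f t = 0" if "t \<notin> S" for t
    using that by (cases t) (auto simp: f_def S_def gauss_binom_def)
  have f1: "f (n, j, l) = x ^ n * q ^ (n * (n + 1) div 2) * (fps_nth (inv_qpoch_fps q y (k - n)) j *
      (fps_nth (qpoch_fps q z (k - n)) l * fps_nth (inv_qpoch_fps q 1 (k - n)) (n - j - l)))"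
    if "n \<le> k" "j \<le> n" "l \<le> n - j" for n j l
  proof -
    have "int (Suc k) - 1 - int n + int j = int (k - n + j)"
      "int (Suc k) - 1 - int j - int l = int (k - n + (n - j - l))"
      "int n - int j - int l = int (n - j - l)" "int (Suc k) - 1 - int n = int (k - n)"
      using that by linarith+
    then have "f (n, j, l) = x ^ n * y ^ j * z ^ l * q ^ (n * (n + 1) div 2 + l * (l - 1) div 2) *
      qb q (k - n + j) j * qb q (k - n + (n - j - l)) (n - j - l) * qb q (k - n) l"
      by (simp only: f_def prod.case qb_def)
    then show ?thesis
      by (simp add: inv_qpoch_fps_def qpoch_fps_def power_add mult_ac)
  qed
  have "g_poly (Suc k) x y z q = infsum f UNIV"
    by (simp only: g_poly_def f_def)
  also have "\<dots> = infsum f S"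
    by (intro infsum_cong_neutral) (auto simp: f0)
  also have "\<dots> = sum f S"
    by (intro infsum_finite) (auto simp: S_def)
  also have "\<dots> = (\<Sum>n\<le>k. \<Sum>j=0..n. \<Sum>l=0..n - j. f (n, j, l))"
    unfolding S_def by (simp add: sum.Sigma split_def)
  also have "\<dots> = (\<Sum>n\<le>k. x ^ n * q ^ (n * (n + 1) div 2) * fps_nth (kernel_fps q y z (k - n)) n)"
    unfolding kernel_fps_def by (intro sum.cong refl) (auto simp: fps_mult_nth sum_distrib_left f1)
  finally show ?thesis .
qed

lemma g_poly_0: "g_poly 0 x y z q = 0"
proof -
  have "gauss_binom q (int 0 - 1 - int n) (int l) = 0" for n l
    by (simp add: gauss_binom_def)
  then show ?thesis by (simp add: g_poly_def split_def)
qed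

section \<open>Three-term recurrences in \<open>k\<close>\<close>

text \<open>In the sums for \<open>e_poly\<close>, a factor \<open>t\<close> lowers \<open>k\<close>
  by one; the top term \<open>n = Suc k\<close> has no constant coefficient and disappears.\<close>

lemma sum_fps_X_mult_antidiagonal:
  fixes u :: "nat \<Rightarrow> complex"
  shows "(\<Sum>n\<le>Suc k. u n * fps_nth (fps_X * F n) (Suc k - n)) = (\<Sum>n\<le>k. u n * fps_nth (F n) (k - n))"
  by (simp add: Suc_diff_le)

lemma sum_fps_X_mult_e_poly:
  "(\<Sum>n\<le>k. x ^ n * q ^ (n * (n + 1) div 2) * fps_nth (fps_X * kernel_fps q y z n) (k - n)) =
    e_poly k x y z q"
proof (cases k)
  case (Suc i)
  then show ?thesis by (simp only: sum_fps_X_mult_antidiagonal e_poly_Suc)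
qed (simp add: e_poly_0)

text \<open>The sum of \<open>u n\<close> times the coefficient of \<open>L n\<close> is evaluated
  twice: by expanding the quadratic factor, and by \<open>kernel_fps_Suc\<close>.\<close>

lemma e_poly_rec:
  assumes "norm q < 1"
  shows "e_poly (Suc (Suc k)) x y z q =
    (1 + y + x * q ^ Suc k) * e_poly (Suc k) x y z q + (z * (x * q ^ k) - y) * e_poly k x y z q"
proof -
  define u where "u n = x ^ n * q ^ (n * (n + 1) div 2)" for n
  define c where "c = kernel_fps q y z"
  define L where "L n = (1 - fps_const 1 * fps_X) * (1 - fps_const y * fps_X) * c n" for n
  have E0: "(\<Sum>n\<le>Suc k. u n * fps_nth (c n) (Suc k - n)) = e_poly (Suc (Suc k)) x y z q"
    by (simp only: e_poly_Suc u_def c_def)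
  have E1: "(\<Sum>n\<le>Suc k. u n * fps_nth (fps_X * c n) (Suc k - n)) = e_poly (Suc k) x y z q"
    by (simp only: sum_fps_X_mult_e_poly u_def c_def)
  have E2: "(\<Sum>n\<le>Suc k. u n * fps_nth (fps_X * (fps_X * c n)) (Suc k - n)) = e_poly k x y z q"
    by (simp only: sum_fps_X_mult_antidiagonal sum_fps_X_mult_e_poly u_def c_def)
  have "(\<Sum>n\<le>Suc k. u n * fps_nth (L n) (Suc k - n)) =
      e_poly (Suc (Suc k)) x y z q - (1 + y) * e_poly (Suc k) x y z q + y * e_poly k x y z q"
    unfolding E0[symmetric] E1[symmetric] E2[symmetric] L_def fps_nth_quadratic_mult sum_distrib_left
      sum_subtractf[symmetric] sum.distrib[symmetric]
    by (intro sum.cong refl) (simp only: algebra_simps mult_1)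
  \<comment> \<open>The term \<open>n = 0\<close> drops out because \<open>L 0 = 1\<close>. In the
    others, \<open>q^(n+1)\<close> from the triangular exponent and \<open>q^(k-n)\<close> from the
    dilation combine to a power free of \<open>n\<close>.\<close>
  moreover have "(\<Sum>n\<le>Suc k. u n * fps_nth (L n) (Suc k - n)) =
      x * q ^ Suc k * e_poly (Suc k) x y z q + z * x * q ^ k * e_poly k x y z q"
  proof -
    have "fps_nth (L 0) (Suc k) = 0"
      using kernel_fps_0[OF assms, of y z] by (simp add: L_def c_def)
    then have "(\<Sum>n\<le>Suc k. u n * fps_nth (L n) (Suc k - n)) =
        (\<Sum>n\<le>k. u (Suc n) * fps_nth (L (Suc n)) (k - n))"
      by (subst sum.atMost_Suc_shift) simp
    also have "\<dots> = (\<Sum>n\<le>k. x * q ^ Suc k * (u n * fps_nth (c n) (k - n)) +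
        z * x * q ^ k * (u n * fps_nth (fps_X * c n) (k - n)))"
    proof (intro sum.cong refl)
      fix n assume n: "n \<in> {..k}"
      have L: "fps_nth (L (Suc n)) (k - n) = q ^ (k - n) * fps_nth (c n) (k - n) +
          z * fps_nth (fps_X * fps_dilate q (c n)) (k - n)"
        using kernel_fps_Suc[OF assms, of y z n] by (simp add: L_def c_def fps_nth_linear_mult del: fps_X_mult_nth)
      \<comment> \<open>The dilated coefficient carries \<open>q^(i-1)\<close>; the additional
        \<open>q\<close>, taken from \<open>u (Suc n)\<close>, completes it to \<open>q^i\<close>
        and covers \<open>i = 0\<close> too.\<close>
      have X: "q * fps_nth (fps_X * fps_dilate q (c n)) i = q ^ i * fps_nth (fps_X * c n) i" for i
        by (cases i) simp_all
      have qk: "q ^ k = q ^ n * q ^ (k - n)" using n by (simp flip: power_add)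
      have u: "u (Suc n) = x * q * q ^ n * u n"
        by (simp only: u_def triangular_Suc power_add power_Suc mult_ac)
      have "u (Suc n) * fps_nth (L (Suc n)) (k - n) =
          x * q * q ^ n * u n * q ^ (k - n) * fps_nth (c n) (k - n) +
          x * q ^ n * u n * z * (q * fps_nth (fps_X * fps_dilate q (c n)) (k - n))"
        unfolding u L by (simp only: algebra_simps)
      then show "u (Suc n) * fps_nth (L (Suc n)) (k - n) = x * q ^ Suc k * (u n * fps_nth (c n) (k - n)) +
        z * x * q ^ k * (u n * fps_nth (fps_X * c n) (k - n))"
        unfolding X power_Suc qk by (simp only: mult_ac)
    qed
    also have "\<dots> = x * q ^ Suc k * e_poly (Suc k) x y z q + z * x * q ^ k * e_poly k x y z q"
      by (simp only: sum.distrib sum_distrib_left[symmetric] u_def c_def e_poly_Suc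
          sum_fps_X_mult_e_poly)
    finally show ?thesis .
  qed
  ultimately show ?thesis by (simp add: algebra_simps)
qed

text \<open>Here a factor \<open>t\<close> shifts \<open>n\<close> itself, which costs
  \<open>x * q^(n+1)\<close>; together with the weight \<open>q^(k-n)\<close> this no longer depends
  on \<open>n\<close>. The spare weight \<open>v\<close> allows a second application to the
  \<open>t^2\<close> term, whose weight is squared.\<close>

lemma sum_fps_X_mult_diagonal:
  fixes F :: "nat \<Rightarrow> complex fps"
  shows "(\<Sum>n\<le>Suc k. x ^ n * q ^ (n * (n + 1) div 2) * q ^ (Suc k - n) * v (Suc k - n) *
      fps_nth (fps_X * F (Suc k - n)) n) =
    x * q ^ Suc k * (\<Sum>n\<le>k. x ^ n * q ^ (n * (n + 1) div 2) * v (k - n) * fps_nth (F (k - n)) n)"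
proof -
  have "(\<Sum>n\<le>Suc k. x ^ n * q ^ (n * (n + 1) div 2) * q ^ (Suc k - n) * v (Suc k - n) *
      fps_nth (fps_X * F (Suc k - n)) n) =
    (\<Sum>n\<le>k. x ^ Suc n * q ^ (Suc n * (Suc n + 1) div 2) * q ^ (k - n) * v (k - n) * fps_nth (F (k - n)) n)"
    by (subst sum.atMost_Suc_shift) simp
  also have "\<dots> = (\<Sum>n\<le>k. x * q ^ Suc k * (x ^ n * q ^ (n * (n + 1) div 2) * v (k - n) * fps_nth (F (k - n)) n))"
  proof (intro sum.cong refl)
    fix n assume n: "n \<in> {..k}"
    have qk: "q ^ k = q ^ n * q ^ (k - n)" using n by (simp flip: power_add)
    show "x ^ Suc n * q ^ (Suc n * (Suc n + 1) div 2) * q ^ (k - n) * v (k - n) * fps_nth (F (k - n)) n =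
        x * q ^ Suc k * (x ^ n * q ^ (n * (n + 1) div 2) * v (k - n) * fps_nth (F (k - n)) n)"
      unfolding triangular_Suc power_add power_Suc qk by (simp only: mult_ac)
  qed
  finally show ?thesis by (simp only: sum_distrib_left)
qed

lemma sum_fps_X_mult_g_poly:
  "(\<Sum>n\<le>k. x ^ n * q ^ (n * (n + 1) div 2) * q ^ (k - n) * fps_nth (fps_X * kernel_fps q y z (k - n)) n) =
    x * q ^ k * g_poly k x y z q"
proof (cases k)
  case (Suc i)
  then show ?thesis
    using sum_fps_X_mult_diagonal[where v = "\<lambda>_. 1" and k = i and x = x and q = q and F = "kernel_fps q y z"]
    by (simp only: g_poly_Suc mult_1_right)
qed (simp add: g_poly_0)

text \<open>Double evaluation as for \<open>e_poly_rec\<close>, now along the other diagonal: the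
  kernel has index \<open>N = Suc k - n\<close>, and \<open>kernel_fps_Suc'\<close> is used.\<close>

lemma g_poly_rec:
  assumes "norm q < 1"
  shows "g_poly (Suc (Suc k)) x y z q =
    (1 + x * q ^ Suc k * (1 + y)) * g_poly (Suc k) x y z q +
    (z * (x * q ^ k) - (x * q ^ k)\<^sup>2 * y * q) * g_poly k x y z q"
proof -
  define u where "u n = x ^ n * q ^ (n * (n + 1) div 2)" for n
  define c where "c = kernel_fps q y z"
  define L where "L N = (1 - fps_const (q ^ N) * fps_X) * (1 - fps_const (y * q ^ N) * fps_X) * c N" for N
  have G1: "(\<Sum>n\<le>k. u n * q ^ (k - n) * fps_nth (fps_X * c (k - n)) n) = x * q ^ k * g_poly k x y z q" for k
    by (simp only: sum_fps_X_mult_g_poly u_def c_def)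
  have G2: "(\<Sum>n\<le>Suc k. u n * q ^ (Suc k - n) * q ^ (Suc k - n) * fps_nth (fps_X * (fps_X * c (Suc k - n))) n) =
      x * q ^ Suc k * (x * q ^ k * g_poly k x y z q)"
    using sum_fps_X_mult_diagonal[where v = "\<lambda>i. q ^ i" and k = k and x = x and q = q and F = "\<lambda>i. fps_X * c i"]
    by (simp only: G1[symmetric] u_def)
  have "(\<Sum>n\<le>Suc k. u n * fps_nth (L (Suc k - n)) n) =
      (\<Sum>n\<le>Suc k. u n * fps_nth (c (Suc k - n)) n)
      - (1 + y) * (\<Sum>n\<le>Suc k. u n * q ^ (Suc k - n) * fps_nth (fps_X * c (Suc k - n)) n)
      + y * (\<Sum>n\<le>Suc k. u n * q ^ (Suc k - n) * q ^ (Suc k - n) * fps_nth (fps_X * (fps_X * c (Suc k - n))) n)"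
    unfolding L_def fps_nth_quadratic_mult sum_distrib_left sum_subtractf[symmetric] sum.distrib[symmetric]
    by (intro sum.cong refl) (simp only: algebra_simps mult_1)
  also have "\<dots> = g_poly (Suc (Suc k)) x y z q - (1 + y) * (x * q ^ Suc k * g_poly (Suc k) x y z q)
      + y * (x * q ^ Suc k * (x * q ^ k * g_poly k x y z q))"
    unfolding G1 G2 by (simp only: u_def c_def g_poly_Suc)
  finally have 1: "(\<Sum>n\<le>Suc k. u n * fps_nth (L (Suc k - n)) n) = \<dots>" .
  \<comment> \<open>Only \<open>n = Suc k\<close> has kernel index \<open>0\<close>, to which
    \<open>kernel_fps_Suc'\<close> does not apply; its contribution is zero since
    \<open>L 0 = 1\<close>.\<close>
  have "fps_nth (L 0) (Suc k) = 0"
    using kernel_fps_0[OF assms, of y z] by (simp add: L_def c_def)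
  then have "(\<Sum>n\<le>Suc k. u n * fps_nth (L (Suc k - n)) n) =
      (\<Sum>n\<le>k. u n * fps_nth (L (Suc (k - n))) n)"
    by (simp add: Suc_diff_le)
  also have "\<dots> = (\<Sum>n\<le>k. u n * fps_nth (c (k - n)) n) +
      z * (\<Sum>n\<le>k. u n * q ^ (k - n) * fps_nth (fps_X * c (k - n)) n)"
    unfolding L_def c_def kernel_fps_Suc'[OF assms] fps_nth_linear_mult sum_distrib_left sum.distrib[symmetric]
    by (intro sum.cong refl) (simp only: algebra_simps)
  also have "\<dots> = g_poly (Suc k) x y z q + z * (x * q ^ k * g_poly k x y z q)"
    unfolding G1 by (simp only: u_def c_def g_poly_Suc)
  finally have "g_poly (Suc (Suc k)) x y z q =
      g_poly (Suc k) x y z q + z * (x * q ^ k * g_poly k x y z q)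
      + (1 + y) * (x * q ^ Suc k * g_poly (Suc k) x y z q)
      - y * (x * q ^ Suc k * (x * q ^ k * g_poly k x y z q))"
    unfolding 1 by (simp add: algebra_simps)
  then show ?thesis
    by (simp add: power2_eq_square algebra_simps)
qed

section \<open>Convergence, \<open>q\<close>-difference equation and expansion of
  \<open>phi\<close>\<close>

lemma summable_ratio_tendsto_0:
  fixes f r :: "nat \<Rightarrow> 'a::{real_normed_field,banach}"
  assumes "\<And>n. f (Suc n) = r n * f n" and "r \<longlonglongrightarrow> 0"
  shows "summable f"
proof -
  have "eventually (\<lambda>n. norm (r n) < 1 / 2) sequentially"
    using order_tendstoD(2)[OF tendsto_norm[OF assms(2)], of "1 / 2"] by simp
  then obtain N where N: "\<And>n. n \<ge> N \<Longrightarrow> norm (r n) < 1 / 2"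
    by (auto simp: eventually_sequentially)
  have "norm (f (Suc n)) \<le> 1 / 2 * norm (f n)" if "n \<ge> N" for n
    unfolding assms(1) norm_mult using N[OF that] by (intro mult_right_mono) auto
  then show ?thesis by (intro summable_ratio_test[of "1 / 2" N]) auto
qed

lemma phi_sums:
  assumes "norm q < 1"
  shows "(\<lambda>n. x ^ n * q ^ (n * (n + 1) div 2) * qpoch (- z) q n / (qpoch y q (n + 1) * qpoch q q n))
    sums phi x y z q"
proof -
  define f where "f n = x ^ n * q ^ (n * (n + 1) div 2) * qpoch (- z) q n /
    (qpoch y q (n + 1) * qpoch q q n)" for n
  define r where "r n = x * q * q ^ n * (1 + z * q ^ n) / ((1 - y * (q * q ^ n)) * (1 - q * q ^ n))" for n
  have q0: "(\<lambda>n. q ^ n) \<longlonglongrightarrow> 0" using assms(1) by (rule LIMSEQ_power_zero)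
  have "r \<longlonglongrightarrow> 0" unfolding r_def by (rule tendsto_eq_intros q0 refl | simp)+
  moreover have "f (Suc n) = r n * f n" for n
    by (simp add: f_def r_def qpoch_Suc triangular_Suc[simplified] power_add mult_ac)
  ultimately have "summable f" by (intro summable_ratio_tendsto_0)
  then show ?thesis unfolding phi_def f_def by (rule summable_sums)
qed

text \<open>The combination \<open>phi x - (1 + y) phi (xq) + y phi (xq^2)\<close> multiplies the
  summand by \<open>(1 - y q^n)(1 - q^n)\<close>. These cancel the last factors of its denominator,
  leaving a multiple of the preceding summand.\<close>

lemma phi_rec:
  assumes "norm q < 1" and nz: "\<forall>n. qpoch y q (n + 1) \<noteq> 0"
  shows "phi x y z q = (1 + y + x * q) * phi (x * q) y z q + (z * x * q - y) * phi (x * q * q) y z q"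
proof -
  define f where "f n = x ^ n * q ^ (n * (n + 1) div 2) * qpoch (- z) q n /
    (qpoch y q (n + 1) * qpoch q q n)" for n
  have s0: "f sums phi x y z q"
    unfolding f_def by (rule phi_sums[OF assms(1)])
  have s1: "(\<lambda>n. q ^ n * f n) sums phi (x * q) y z q"
    using phi_sums[OF assms(1), of "x * q" z] by (simp add: f_def power_mult_distrib mult_ac)
  have s2: "(\<lambda>n. q ^ n * (q ^ n * f n)) sums phi (x * q * q) y z q"
    using phi_sums[OF assms(1), of "x * q * q" z] by (simp add: f_def power_mult_distrib mult_ac)
  have "(\<lambda>n. f n - (1 + y) * (q ^ n * f n) + y * (q ^ n * (q ^ n * f n))) sums
      (phi x y z q - (1 + y) * phi (x * q) y z q + y * phi (x * q * q) y z q)"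
    by (intro sums_add sums_diff sums_mult s0 s1 s2)
  moreover have "f n - (1 + y) * (q ^ n * f n) + y * (q ^ n * (q ^ n * f n)) =
      (1 - y * q ^ n) * (1 - q ^ n) * f n" for n
    by (simp add: algebra_simps)
  ultimately have "(\<lambda>n. (1 - y * q ^ n) * (1 - q ^ n) * f n) sums
      (phi x y z q - (1 + y) * phi (x * q) y z q + y * phi (x * q * q) y z q)"
    by simp
  \<comment> \<open>The term at \<open>0\<close> contains \<open>1 - q^0 = 0\<close>, so the series
    may start at \<open>1\<close>.\<close>
  then have "(\<lambda>n. (1 - y * q ^ Suc n) * (1 - q ^ Suc n) * f (Suc n)) sums
      (phi x y z q - (1 + y) * phi (x * q) y z q + y * phi (x * q * q) y z q)"
    by (subst sums_Suc_iff) simp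
  moreover have "(1 - y * q ^ Suc n) * (1 - q ^ Suc n) * f (Suc n) =
      x * q * (q ^ n * f n) + z * x * q * (q ^ n * (q ^ n * f n))" for n
  proof -
    have "1 - y * q ^ Suc n \<noteq> 0" "1 - q ^ Suc n \<noteq> 0"
      using nz[rule_format, of "Suc n"] q_power_neq_1[OF assms(1), of n]
      by (auto simp: qpoch_Suc)
    moreover have "f (Suc n) = x * q * q ^ n * (1 + z * q ^ n) /
        ((1 - y * q ^ Suc n) * (1 - q ^ Suc n)) * f n"
      by (simp add: f_def qpoch_Suc triangular_Suc[simplified] power_add mult_ac)
    ultimately have "(1 - y * q ^ Suc n) * (1 - q ^ Suc n) * f (Suc n) = x * q * q ^ n * (1 + z * q ^ n) * f n"
      by simp
    also have "\<dots> = x * q * (q ^ n * f n) + z * x * q * (q ^ n * (q ^ n * f n))"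
      by (simp add: algebra_simps)
    finally show ?thesis .
  qed
  ultimately have "(\<lambda>n. x * q * (q ^ n * f n) + z * x * q * (q ^ n * (q ^ n * f n))) sums
      (phi x y z q - (1 + y) * phi (x * q) y z q + y * phi (x * q * q) y z q)"
    by (simp only:)
  moreover have "(\<lambda>n. x * q * (q ^ n * f n) + z * x * q * (q ^ n * (q ^ n * f n))) sums
      (x * q * phi (x * q) y z q + z * x * q * phi (x * q * q) y z q)"
    by (intro sums_add sums_mult s1 s2)
  ultimately have "phi x y z q - (1 + y) * phi (x * q) y z q + y * phi (x * q * q) y z q =
      x * q * phi (x * q) y z q + z * x * q * phi (x * q * q) y z q"
    by (rule sums_unique2)
  then show ?thesis by (simp add: algebra_simps)
qed

text \<open>Applying \<open>phi_rec\<close> at \<open>x q^m\<close> and collecting terms reproduces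
  \<open>e_poly_rec\<close>. Starting at \<open>x\<close> and moving to \<open>x q^m\<close> keeps
  negative powers of \<open>q\<close> out of the induction.\<close>

lemma phi_expansion:
  assumes "norm q < 1" and "\<forall>n. qpoch y q (n + 1) \<noteq> 0"
  shows "phi x y z q = e_poly (Suc m) x y z q * phi (x * q ^ m) y z q +
    (z * (x * q ^ m) - y) * e_poly m x y z q * phi (x * q ^ m * q) y z q"
proof (induction m)
  case 0
  have "fps_nth (kernel_fps q y z 0) 0 = 1"
    using arg_cong[OF kernel_fps_0[OF assms(1), of y z], of "\<lambda>F. fps_nth F 0"] by simp
  then show ?case by (simp add: e_poly_Suc e_poly_0)
next
  case (Suc m)
  show ?case
    unfolding Suc.IH e_poly_rec[OF assms(1), of m] phi_rec[OF assms, of "x * q ^ m"]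
    by (simp add: algebra_simps)
qed

section \<open>Convergence, \<open>q\<close>-difference equation and expansion of
  \<open>Phi\<close>\<close>

lemma Phi_sums:
  assumes "norm q < 1"
  shows "(\<lambda>n. x ^ n * q ^ (n * (n + 1) div 2) * qpoch (- z) q n /
    (qpoch (- (x * y * q)) q n * qpoch q q n)) sums Phi x y z q"
proof -
  define f where "f n = x ^ n * q ^ (n * (n + 1) div 2) * qpoch (- z) q n /
    (qpoch (- (x * y * q)) q n * qpoch q q n)" for n
  define r where "r n = x * q * q ^ n * (1 + z * q ^ n) / ((1 + x * y * q * q ^ n) * (1 - q * q ^ n))" for n
  have q0: "(\<lambda>n. q ^ n) \<longlonglongrightarrow> 0" using assms(1) by (rule LIMSEQ_power_zero)
  have "r \<longlonglongrightarrow> 0" unfolding r_def by (rule tendsto_eq_intros q0 refl | simp)+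
  moreover have "f (Suc n) = r n * f n" for n
    by (simp add: f_def r_def qpoch_Suc triangular_Suc[simplified] power_add mult_ac)
  ultimately have "summable f" by (intro summable_ratio_tendsto_0)
  then show ?thesis unfolding Phi_def f_def by (rule summable_sums)
qed

text \<open>The denominator \<open>(-xyq;q)_n\<close> moves with \<open>x\<close>, so the three
  summands are related by rational, not polynomial, functions of \<open>q^n\<close>. The relation is
  therefore proved by telescoping.\<close>

lemma Phi_rec:
  assumes "norm q < 1" and nz: "\<forall>n. qpoch (- (x * y * q)) q n \<noteq> 0"
  shows "(1 + x * y * q) * Phi x y z q = (1 + x * q + x * y * q) * Phi (x * q) y z q +
    (z * (x * q) - (x * q)\<^sup>2 * y * q) / (1 + x * q * y * q) * Phi (x * q * q) y z q"
proof -
  define t where "t x n = x ^ n * q ^ (n * (n + 1) div 2) * qpoch (- z) q n /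
    (qpoch (- (x * y * q)) q n * qpoch q q n)" for x n
  define a where "a = x * y * q"
  \<comment> \<open>found by \<open>q\<close>-Gosper summation: the summand of the claimed relation is \<open>G n - G (Suc n)\<close>\<close>
  define G where "G n = t x n * (1 - q ^ n) * (1 + a) / (1 + a * q ^ n)" for n
  have s: "t x sums Phi x y z q" for x
    unfolding t_def by (rule Phi_sums[OF assms(1)])
  have nza: "1 + a * q ^ n \<noteq> 0" for n
    using qpoch_factor_nonzero[OF nz, of n] by (simp add: a_def)
  have step: "(1 + a) * t x n - (1 + x * q + a) * t (x * q) n -
      (z * (x * q) - (x * q)\<^sup>2 * y * q) / (1 + a * q) * t (x * q * q) n = G n - G (Suc n)" for n
  proof -
    define Q where "Q = q ^ n"
    have n0: "1 + a \<noteq> 0" "1 + a * q \<noteq> 0" "1 + a * Q \<noteq> 0" "1 + a * q * Q \<noteq> 0"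
      using nza[of 0] nza[of 1] nza[of n] nza[of "Suc n"] by (simp_all add: Q_def mult_ac)
    have nq: "1 - q * Q \<noteq> 0" using q_power_neq_1[OF assms(1), of n] by (simp add: Q_def)
    \<comment> \<open>Shifting the base by \<open>q\<close> trades the first factor for a new last
      one; \<open>p1\<close> and \<open>p2\<close> thus express all summands through
      \<open>t x n\<close>.\<close>
    have p1: "qpoch (- (a * q)) q n = qpoch (- a) q n * (1 + a * Q) / (1 + a)"
      using qpoch_Suc[of "- a" q n] qpoch_Suc_left[of "- a" q n] n0(1)
      by (simp add: field_simps Q_def)
    have p2: "qpoch (- (a * q * q)) q n = qpoch (- (a * q)) q n * (1 + a * q * Q) / (1 + a * q)"
      using qpoch_Suc[of "- (a * q)" q n] qpoch_Suc_left[of "- (a * q)" q n] n0(2)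
      by (simp add: field_simps Q_def)
    have "t (x * q) n = Q * (x ^ n * q ^ (n * (n + 1) div 2) * qpoch (- z) q n /
        (qpoch (- (a * q)) q n * qpoch q q n))"
      by (simp add: t_def a_def Q_def power_mult_distrib mult_ac)
    also have "\<dots> = t x n * (Q * (1 + a) / (1 + a * Q))"
      unfolding p1 by (simp add: t_def a_def mult_ac)
    finally have t1: "t (x * q) n = \<dots>" .
    have "t (x * q * q) n = Q * Q * (x ^ n * q ^ (n * (n + 1) div 2) * qpoch (- z) q n /
        (qpoch (- (a * q * q)) q n * qpoch q q n))"
      by (simp add: t_def a_def Q_def power_mult_distrib mult_ac)
    also have "\<dots> = t x n * (Q * Q * (1 + a) * (1 + a * q) / ((1 + a * Q) * (1 + a * q * Q)))"
      unfolding p2 p1 by (simp add: t_def a_def mult_ac)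
    finally have t2: "t (x * q * q) n = \<dots>" .
    have t3: "t x (Suc n) = t x n * (x * q * Q * (1 + z * Q) / ((1 + a * Q) * (1 - q * Q)))"
      by (simp add: t_def a_def Q_def qpoch_Suc triangular_Suc[simplified] power_add mult_ac)
    have G: "G n = t x n * ((1 - Q) * (1 + a) / (1 + a * Q))"
      "G (Suc n) = t x n * (x * q * Q * (1 + z * Q) * (1 + a) / ((1 + a * Q) * (1 + a * q * Q)))"
      using nq n0 unfolding G_def t3 by (simp_all add: Q_def mult_ac)
    have sq: "(x * q)\<^sup>2 * y * q = x * a * q * q"
      by (simp add: a_def power2_eq_square)
    have "(1 + a) - (1 + x * q + a) * (Q * (1 + a) / (1 + a * Q)) -
       (z * (x * q) - x * a * q * q) / (1 + a * q) * (Q * Q * (1 + a) * (1 + a * q) / ((1 + a * Q) * (1 + a * q * Q)))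
       = (1 - Q) * (1 + a) / (1 + a * Q) -
         x * q * Q * (1 + z * Q) * (1 + a) / ((1 + a * Q) * (1 + a * q * Q))"
      using n0 by (simp add: divide_simps) algebra
    \<comment> \<open>The rational identity is multiplied by \<open>t x n\<close> rather than
      obtained by division, since \<open>t x n\<close> may vanish.\<close>
    moreover have "A * T - B * (T * C) - D * (T * E) = T * F - T * H"
      if "A - B * C - D * E = F - H" for A B C D E F H T :: complex
    proof -
      have "A * T - B * (T * C) - D * (T * E) = T * (A - B * C - D * E)"
        by (simp add: algebra_simps)
      then show ?thesis unfolding that by (simp only: right_diff_distrib)
    qed
    ultimately show ?thesis unfolding t1 t2 G sq by blast
  qed
  have "G \<longlonglongrightarrow> 0"
  proof -
    have q0: "(\<lambda>n. q ^ n) \<longlonglongrightarrow> 0" using assms(1) by (rule LIMSEQ_power_zero)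
    have t0: "t x \<longlonglongrightarrow> 0" using s summable_LIMSEQ_zero sums_summable by blast
    show ?thesis unfolding G_def by (rule tendsto_eq_intros q0 t0 refl | simp)+
  qed
  \<comment> \<open>Both boundary terms vanish: the limit because the summands of a convergent
    series tend to zero, and \<open>G 0\<close> because of its factor
    \<open>1 - q^0\<close>.\<close>
  then have "(\<lambda>n. G n - G (Suc n)) sums (G 0 - 0)" by (rule telescope_sums')
  moreover have "G 0 = 0" by (simp add: G_def)
  ultimately have "(\<lambda>n. G n - G (Suc n)) sums 0" by simp
  moreover have "(\<lambda>n. G n - G (Suc n)) sums ((1 + a) * Phi x y z q - (1 + x * q + a) * Phi (x * q) y z q -
      (z * (x * q) - (x * q)\<^sup>2 * y * q) / (1 + a * q) * Phi (x * q * q) y z q)"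
    unfolding step[symmetric] by (intro sums_diff sums_mult s)
  ultimately have *: "(1 + a) * Phi x y z q - (1 + x * q + a) * Phi (x * q) y z q -
      (z * (x * q) - (x * q)\<^sup>2 * y * q) / (1 + a * q) * Phi (x * q * q) y z q = 0"
    using sums_unique2 by blast
  have "1 + a * q = 1 + x * q * y * q" by (simp add: a_def)
  with * show ?thesis unfolding a_def by (simp only: diff_diff_eq right_minus_eq)
qed

lemma qpoch_shift_power_nonzero:
  assumes "\<forall>n. qpoch a q n \<noteq> 0"
  shows "\<forall>n. qpoch (a * q ^ m) q n \<noteq> 0"
proof (induction m)
  case (Suc m)
  show ?case using qpoch_shift_nonzero[OF Suc.IH] by (simp add: mult_ac)
qed (use assms in simp)

text \<open>Each use of \<open>Phi_rec\<close> brings a factor \<open>1 + x q^m y q\<close> to the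
  left; their product is the \<open>q\<close>-Pochhammer symbol in front.\<close>

lemma Phi_expansion:
  assumes "norm q < 1" and nz: "\<forall>n. qpoch (- (x * y * q)) q n \<noteq> 0"
  shows "qpoch (- (x * y * q)) q m * Phi x y z q = g_poly (Suc m) x y z q * Phi (x * q ^ m) y z q +
    (z * (x * q ^ m) - (x * q ^ m)\<^sup>2 * y * q) / (1 + x * q ^ m * y * q) *
    g_poly m x y z q * Phi (x * q ^ m * q) y z q"
proof (induction m)
  case 0
  have "fps_nth (kernel_fps q y z 0) 0 = 1"
    using arg_cong[OF kernel_fps_0[OF assms(1), of y z], of "\<lambda>F. fps_nth F 0"] by simp
  then show ?case by (simp add: g_poly_Suc g_poly_0)
next
  case (Suc m)
  define w where "w = x * q ^ m"
  define R where "R = (z * (w * q) - (w * q)\<^sup>2 * y * q) / (1 + w * q * y * q)"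
  have nzw: "\<forall>n. qpoch (- (w * y * q)) q n \<noteq> 0"
    using qpoch_shift_power_nonzero[OF nz, of m] by (simp add: w_def mult_ac)
  have w1: "1 + w * y * q \<noteq> 0"
    using qpoch_factor_nonzero[OF nzw, of 0] by simp
  have w2: "x * q ^ Suc m = w * q" by (simp add: w_def)
  have rec: "g_poly (Suc (Suc m)) x y z q = (1 + w * q * (1 + y)) * g_poly (Suc m) x y z q +
      (z * w - w\<^sup>2 * y * q) * g_poly m x y z q"
    unfolding g_poly_rec[OF assms(1)] w_def by (simp add: mult_ac)
  \<comment> \<open>The new factor \<open>1 + w * y * q\<close> does two things: it cancels the
    denominator in the induction hypothesis and provides the left side of \<open>Phi_rec\<close> at
    \<open>w\<close>.\<close>
  have "qpoch (- (x * y * q)) q (Suc m) * Phi x y z q =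
      (1 + w * y * q) * (qpoch (- (x * y * q)) q m * Phi x y z q)"
    by (simp add: qpoch_Suc w_def mult_ac)
  also have "\<dots> = g_poly (Suc m) x y z q * ((1 + w * y * q) * Phi w y z q) +
      (z * w - w\<^sup>2 * y * q) * g_poly m x y z q * Phi (w * q) y z q"
    unfolding Suc.IH w_def[symmetric] using w1 by (simp add: distrib_left)
  also have "\<dots> = g_poly (Suc (Suc m)) x y z q * Phi (w * q) y z q +
    (z * (w * q) - (w * q)\<^sup>2 * y * q) / (1 + w * q * y * q) *
    g_poly (Suc m) x y z q * Phi (w * q * q) y z q"
    unfolding Phi_rec[OF assms(1) nzw] rec R_def[symmetric] by (simp add: algebra_simps)
  finally show ?case unfolding w2 .
qed

section \<open>The prefactor in (ii) and the final assembly\<close>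

text \<open>Both sides equal the product of \<open>b q^m + q^k\<close> over \<open>k < m\<close>:
  pull out \<open>b q^m\<close> or \<open>q^k\<close>. It is used with
  \<open>b = x y q^(-m)\<close>, so that \<open>b q^m = x y\<close>.\<close>

lemma qpoch_inverse_base:
  assumes "b \<noteq> 0" and "q \<noteq> 0"
  shows "(b * q ^ m) ^ m * qpoch (- 1 / (b * q ^ m)) q m = q ^ (m * (m - 1) div 2) * qpoch (- (b * q)) q m"
proof -
  have "(b * q ^ m) ^ m * qpoch (- 1 / (b * q ^ m)) q m = (\<Prod>k<m. b * q ^ m + q ^ k)"
  proof -
    have "b * q ^ m + q ^ k = b * q ^ m * (1 - - 1 / (b * q ^ m) * q ^ k)" for k
      using assms by (simp add: field_simps)
    then show ?thesis by (simp only: qpoch_def prod.distrib prod_constant card_lessThan power_mult_distrib)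
  qed
  also have "\<dots> = (\<Prod>k<m. q ^ k * (1 + b * q ^ (m - k)))"
  proof (intro prod.cong refl)
    fix k assume "k \<in> {..<m}"
    then have "q ^ m = q ^ k * q ^ (m - k)" by (simp flip: power_add)
    then show "b * q ^ m + q ^ k = q ^ k * (1 + b * q ^ (m - k))" by (simp add: algebra_simps)
  qed
  also have "\<dots> = (\<Prod>k<m. q ^ k) * (\<Prod>k<m. 1 + b * q ^ (m - k))"
    by (rule prod.distrib)
  also have "(\<Prod>k<m. q ^ k) = q ^ (m * (m - 1) div 2)"
    by (induction m) (simp_all add: triangular_pred_Suc[simplified] power_add mult.commute)
  \<comment> \<open>The order of the factors is reversed, \<open>k\<close> becoming
    \<open>m - 1 - k\<close>.\<close>
  also have "(\<Prod>k<m. 1 + b * q ^ (m - k)) = (\<Prod>k<m. 1 + b * q ^ (Suc k))"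
    by (subst prod.nat_diff_reindex[symmetric]) (auto intro!: prod.cong simp: Suc_diff_Suc)
  also have "\<dots> = qpoch (- (b * q)) q m"
    by (simp add: qpoch_def mult_ac)
  finally show ?thesis .
qed

theorem theorem4p1:
  fixes m :: nat and x y z q :: complex
  assumes "m \<ge> 1" and "norm q < 1" and "q \<noteq> 0"
  shows
    "((\<forall>n. qpoch y q (n + 1) \<noteq> 0) \<longrightarrow>
        phi (x / q ^ m) y z q =
          e_poly (m + 1) (x / q ^ m) y z q * phi x y z q
          + (z * x - y) * e_poly m (x / q ^ m) y z q * phi (x * q) y z q)
     \<and>
     (x \<noteq> 0 \<and> y \<noteq> 0 \<and> qpoch (- 1 / (x * y)) q m \<noteq> 0 \<and> 1 + x * y * q \<noteq> 0 \<and>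
      (\<forall>n. qpoch (- ((x / q ^ m) * y * q)) q n \<noteq> 0) \<and>
      (\<forall>n. qpoch (- (x * y * q)) q n \<noteq> 0) \<and>
      (\<forall>n. qpoch (- ((x * q) * y * q)) q n \<noteq> 0) \<longrightarrow>
        Phi (x / q ^ m) y z q =
          q ^ (m * (m - 1) div 2) / (x ^ m * y ^ m * qpoch (- 1 / (x * y)) q m) *
          (g_poly (m + 1) (x / q ^ m) y z q * Phi x y z q
           + (z * x - x\<^sup>2 * y * q) / (1 + x * y * q) *
             g_poly m (x / q ^ m) y z q * Phi (x * q) y z q))"
proof (intro conjI impI)
  \<comment> \<open>Both expansions are applied with base point \<open>w\<close>, so that
    \<open>m\<close> steps lead back to \<open>x\<close>.\<close>
  define w where "w = x / q ^ m"
  have x: "w * q ^ m = x" using assms(3) by (simp add: w_def)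
  show "phi (x / q ^ m) y z q = e_poly (m + 1) (x / q ^ m) y z q * phi x y z q
      + (z * x - y) * e_poly m (x / q ^ m) y z q * phi (x * q) y z q"
    if "\<forall>n. qpoch y q (n + 1) \<noteq> 0"
    using phi_expansion[OF assms(2) that, of w z m] unfolding x by (simp add: w_def)
  assume *: "x \<noteq> 0 \<and> y \<noteq> 0 \<and> qpoch (- 1 / (x * y)) q m \<noteq> 0 \<and> 1 + x * y * q \<noteq> 0 \<and>
      (\<forall>n. qpoch (- ((x / q ^ m) * y * q)) q n \<noteq> 0) \<and>
      (\<forall>n. qpoch (- (x * y * q)) q n \<noteq> 0) \<and>
      (\<forall>n. qpoch (- ((x * q) * y * q)) q n \<noteq> 0)"
  then have nz: "\<forall>n. qpoch (- (w * y * q)) q n \<noteq> 0" by (simp add: w_def)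
  have "w * y \<noteq> 0" using * assms(3) by (simp add: w_def)
  from qpoch_inverse_base[OF this assms(3), of m]
  have "x ^ m * y ^ m * qpoch (- 1 / (x * y)) q m = q ^ (m * (m - 1) div 2) * qpoch (- (w * y * q)) q m"
    by (simp add: x[symmetric] power_mult_distrib mult_ac)
  \<comment> \<open>The prefactor is exactly the reciprocal of the \<open>q\<close>-Pochhammer
    symbol in \<open>Phi_expansion\<close>.\<close>
  then have pre: "q ^ (m * (m - 1) div 2) / (x ^ m * y ^ m * qpoch (- 1 / (x * y)) q m) =
      1 / qpoch (- (w * y * q)) q m"
    using assms(3) by simp
  show "Phi (x / q ^ m) y z q =
          q ^ (m * (m - 1) div 2) / (x ^ m * y ^ m * qpoch (- 1 / (x * y)) q m) *
          (g_poly (m + 1) (x / q ^ m) y z q * Phi x y z q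
           + (z * x - x\<^sup>2 * y * q) / (1 + x * y * q) *
             g_poly m (x / q ^ m) y z q * Phi (x * q) y z q)"
    unfolding pre w_def[symmetric] Suc_eq_plus1[symmetric]
      Phi_expansion[OF assms(2) nz, of m z, unfolded x, symmetric]
    using nz by simp
qed

end
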